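(* Let $n, k \ge 1$ be integers and let $\theta > 0$ be defined by $k = \theta\sqrt{n}$. Drop $k$ balls independently and uniformly into $n$ boxes, and let $W$ be the number of boxes containing at least two balls. Then $$\|\mathcal{L}(W) - \mathrm{Poi}_{\theta^2/2}\|_{TV} \leq \min\{1, \sqrt{2}\,\theta^{-1}\}\left[\frac{19\theta^3 + 6\theta}{12\sqrt{n}} + \frac{\theta^2}{2n}\right].$$
   Context: $\mathcal{L}(W)$ denotes the law of $W$ and $\mathrm{Poi}_\lambda$ the Poisson distribution with mean $\lambda$ on $\{0,1,2,\ldots\}$. The total variation distance is $\|\mu-\nu\|_{TV} = \sup_A |\mu(A)-\nu(A)|$, the supremum being over all measurable sets $A$. *)

theory Defs
  imports "HOL-Probability.Probability"
begin

(* Meant for finite measures with sets M = sets N; for probability measures the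
   supremum is over a nonempty set bounded by 1. *)
definition tv_dist :: "'a measure \<Rightarrow> 'a measure \<Rightarrow> real" where
  "tv_dist M N = (SUP A\<in>sets M. \<bar>measure M A - measure N A\<bar>)"

(* Balls are indexed by {..<k} and boxes by {..<n}; x i is the box of ball i. *)
definition multi_boxes :: "nat \<Rightarrow> nat \<Rightarrow> (nat \<Rightarrow> nat) \<Rightarrow> nat" where
  "multi_boxes n k x = card {b\<in>{..<n}. 2 \<le> card {i\<in>{..<k}. x i = b}}"

end

theory Submission
  imports Defs
begin

text \<open>
  The proof is the Stein-Chen method. Put $\lambda = \theta^2/2 = k^2/(2n)$ and let $f$ solve
  $\lambda f(j+1) - j f(j) = 1_A(j) - \mathrm{Poi}_\lambda(A)$; the error to bound is
  $E[\lambda f(W+1) - W f(W)]$. Replace $W$ by the number $Y$ of pairs of balls sharing a box,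
  at the cost $E(Y - W) = O(k^3/n^2)$. Conditioning on balls $i$ and $j$ sharing a box amounts to
  moving ball $j$ into the box of ball $i$, and this turns $W$ into $W + 1$ unless a third ball
  is in one of the two boxes involved. What remains is the difference
  $\lambda - E Y = k/(2n)$, together with the bounds
  $|f| \le 1$, $|f| \le 3/\sqrt\lambda$ (if $\lambda \ge 1$) and
  $|\Delta f| \le \min\{1, 1/\lambda\}$. The constant $3$ is not sharp, but the loss it causes in the
  terms multiplied by $|f|$ is absorbed by the gain of $1/\lambda$ over
  $1/\sqrt\lambda$ in the term multiplied by $|\Delta f|$.
\<close>

section \<open>The Stein equation of the Poisson distribution\<close>

definition poi :: "real \<Rightarrow> nat \<Rightarrow> real" where
  "poi l j = exp (- l) * l ^ j / fact j"

definition poi_cdf :: "real \<Rightarrow> nat \<Rightarrow> real" where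
  "poi_cdf l m = (\<Sum>j\<le>m. poi l j)"

lemma poi_pos: "0 < l \<Longrightarrow> 0 < poi l j"
  by (simp add: poi_def)

lemma poi_Suc: "real (Suc m) * poi l (Suc m) = l * poi l m"
  by (simp add: poi_def field_simps del: of_nat_Suc)

lemma poi_cdf_Suc: "poi_cdf l (Suc m) = poi_cdf l m + poi l (Suc m)"
  by (simp add: poi_cdf_def)

lemma poi_cdf_pos: "0 < l \<Longrightarrow> 0 < poi_cdf l m"
  unfolding poi_cdf_def by (rule sum_pos) (auto simp: poi_pos)

lemma poi_sums: "poi l sums 1"
proof -
  have "(\<lambda>j. exp (- l) * (l ^ j / fact j)) sums (exp (- l) * exp l)"
    using exp_converges[of l] by (intro sums_mult) (simp add: divide_inverse mult.commute)
  then show ?thesis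
    by (simp add: poi_def[abs_def] flip: exp_add)
qed

lemma poi_tail_sums: "(\<lambda>i. poi l (i + Suc m)) sums (1 - poi_cdf l m)"
  using sums_split_initial_segment[OF poi_sums[of l], of "Suc m"]
  by (simp add: poi_cdf_def lessThan_Suc_atMost)

lemma poi_cdf_le_1: "0 < l \<Longrightarrow> poi_cdf l m \<le> 1"
  using sums_le[OF _ sums_zero poi_tail_sums[of l m]] poi_pos[of l] by (simp add: less_imp_le)

text \<open>Shift the sum by \<open>poi_Suc\<close> and bound the factor \<open>Suc j\<close> by
  \<open>Suc m\<close>. The shift misses the term at \<open>0\<close>, which is
  \<open>exp (- l)\<close>; it is carried along because \<open>stein_sol_diff_le\<close> ends in
  \<open>1 - exp (- l)\<close>.\<close>

lemma poi_cdf_ratio: 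
  assumes "0 < l"
  shows "l * poi_cdf l m \<le> real (Suc m) * (poi_cdf l (Suc m) - exp (- l))"
proof -
  have "poi_cdf l (Suc m) = poi l 0 + (\<Sum>j\<le>m. poi l (Suc j))"
    unfolding poi_cdf_def by (rule sum.atMost_Suc_shift)
  then have eq: "poi_cdf l (Suc m) - exp (- l) = (\<Sum>j\<le>m. poi l (Suc j))"
    by (simp add: poi_def)
  have "l * poi_cdf l m = (\<Sum>j\<le>m. real (Suc j) * poi l (Suc j))"
    by (simp add: poi_cdf_def sum_distrib_left poi_Suc del: of_nat_Suc)
  also have "\<dots> \<le> (\<Sum>j\<le>m. real (Suc m) * poi l (Suc j))"
    using poi_pos[OF assms] by (intro sum_mono mult_right_mono) (auto simp: less_imp_le)
  finally show ?thesis by (simp add: eq sum_distrib_left del: of_nat_Suc)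
qed

text \<open>Termwise, \<open>Suc m <= Suc (i + m)\<close> and \<open>poi_Suc\<close> compare the
  tail beyond \<open>m\<close> with the tail from \<open>m\<close> on, which has the additional mass
  \<open>poi l m\<close>.\<close>

lemma poi_tail_ratio:
  assumes "0 < l"
  shows "real (Suc m) * (1 - poi_cdf l m) \<le> l * (1 - poi_cdf l m + poi l m)"
proof (rule sums_le)
  show "(\<lambda>i. real (Suc m) * poi l (i + Suc m)) sums (real (Suc m) * (1 - poi_cdf l m))"
    by (intro sums_mult poi_tail_sums)
  have "(\<lambda>i. poi l (i + m)) sums (1 - (\<Sum>i<m. poi l i))"
    using poi_sums by (rule sums_split_initial_segment)
  moreover have "1 - (\<Sum>i<m. poi l i) = 1 - poi_cdf l m + poi l m"
    by (simp add: poi_cdf_def flip: lessThan_Suc_atMost)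
  ultimately show "(\<lambda>i. l * poi l (i + m)) sums (l * (1 - poi_cdf l m + poi l m))"
    by (intro sums_mult) simp
  show "real (Suc m) * poi l (i + Suc m) \<le> l * poi l (i + m)" for i
  proof -
    have "real (Suc m) * poi l (i + Suc m) \<le> real (Suc (i + m)) * poi l (i + Suc m)"
      using poi_pos[OF assms, of "i + Suc m"] by (intro mult_right_mono) auto
    then show ?thesis using poi_Suc[of "i + m" l] by simp
  qed
qed

text \<open>
  Of the two inequalities added here, one says that the mean of the Poisson law conditioned on exceeding
  \<open>m\<close> is at least \<open>m + 1\<close>, the other that conditioned on not exceeding \<open>m\<close>
  it is at most \<open>m\<close>; the claim is that these conditional means differ by at least 1.
\<close>
lemma cdf_tail_le:
  assumes "0 < l"
  shows "poi_cdf l m * (1 - poi_cdf l m) \<le> l * poi l m"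
proof -
  have F: "0 < poi_cdf l m" "poi_cdf l m \<le> 1"
    using poi_cdf_pos poi_cdf_le_1 assms by auto
  have 1: "poi_cdf l m * (real (Suc m) * (1 - poi_cdf l m)) \<le> poi_cdf l m * (l * (1 - poi_cdf l m + poi l m))"
    using F poi_tail_ratio[OF assms, of m] by (intro mult_left_mono) auto
  have "l * (poi_cdf l m - poi l m) \<le> real m * poi_cdf l m"
  proof (cases m)
    case 0 then show ?thesis by (simp add: poi_cdf_def)
  next
    case (Suc j)
    have "l * poi_cdf l j \<le> real (Suc j) * (poi_cdf l (Suc j) - exp (- l))"
      by (rule poi_cdf_ratio[OF assms])
    also have "\<dots> \<le> real (Suc j) * poi_cdf l (Suc j)"
      by (intro mult_left_mono) auto
    finally show ?thesis using Suc by (simp add: poi_cdf_Suc)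
  qed
  then have 2: "(1 - poi_cdf l m) * (l * (poi_cdf l m - poi l m)) \<le> (1 - poi_cdf l m) * (real m * poi_cdf l m)"
    using F by (intro mult_left_mono) auto
  \<comment> \<open>When \<open>1\<close> and \<open>2\<close> are added, the multiples of F(1 - F)
    by \<open>l\<close> and \<open>m\<close> cancel up to one copy, where F is
    \<open>poi_cdf l m\<close>. The two terms with \<open>l * poi l m\<close> have weights F and 1 -
    F.\<close>
  from 1 2 show ?thesis by (simp add: algebra_simps)
qed

text \<open>By \<open>poi_Suc\<close>, one step is a weakened \<open>poi_cdf_ratio\<close>. Together
  with \<open>tail_div_poi_antimono\<close> this moves bounds to the mode and fixes the signs in
  \<open>stein_sol_diff_le\<close>.\<close>

lemma cdf_div_poi_mono:
  assumes "0 < l"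
  shows "mono (\<lambda>m. poi_cdf l m / poi l m)"
proof (rule incseq_SucI)
  fix m
  have "l * poi_cdf l m \<le> real (Suc m) * poi_cdf l (Suc m)"
    by (rule order.trans[OF poi_cdf_ratio[OF assms]]) (intro mult_left_mono, auto)
  then have "poi l (Suc m) * (l * poi_cdf l m) \<le> poi l (Suc m) * (real (Suc m) * poi_cdf l (Suc m))"
    using poi_pos[OF assms, of "Suc m"] by (intro mult_left_mono) auto
  also have "\<dots> = l * poi l m * poi_cdf l (Suc m)"
    by (simp add: poi_Suc[symmetric] del: of_nat_Suc)
  finally have "poi l (Suc m) * poi_cdf l m \<le> poi l m * poi_cdf l (Suc m)"
    using assms by (simp add: mult_ac)
  then show "poi_cdf l m / poi l m \<le> poi_cdf l (Suc m) / poi l (Suc m)"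
    using poi_pos[OF assms] by (simp add: field_simps)
qed

lemma tail_div_poi_antimono:
  assumes "0 < l"
  shows "antimono (\<lambda>m. (1 - poi_cdf l m) / poi l m)"
proof (rule decseq_SucI)
  fix m
  have "real (Suc m) * (1 - poi_cdf l (Suc m)) \<le> real (Suc (Suc m)) * (1 - poi_cdf l (Suc m))"
    using poi_cdf_le_1[OF assms, of "Suc m"] by (intro mult_right_mono) auto
  also have "\<dots> \<le> l * (1 - poi_cdf l m)"
    using poi_tail_ratio[OF assms, of "Suc m"] by (simp add: poi_cdf_Suc)
  finally have "poi l (Suc m) * (real (Suc m) * (1 - poi_cdf l (Suc m))) \<le> poi l (Suc m) * (l * (1 - poi_cdf l m))"
    using poi_pos[OF assms, of "Suc m"] by (intro mult_left_mono) auto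
  moreover have "poi l (Suc m) * (real (Suc m) * (1 - poi_cdf l (Suc m))) = l * (poi l m * (1 - poi_cdf l (Suc m)))"
    by (simp add: poi_Suc[symmetric] del: of_nat_Suc)
  ultimately have "l * (poi l m * (1 - poi_cdf l (Suc m))) \<le> l * (poi l (Suc m) * (1 - poi_cdf l m))"
    by (simp only: mult.left_commute)
  then have "poi l m * (1 - poi_cdf l (Suc m)) \<le> poi l (Suc m) * (1 - poi_cdf l m)"
    using assms by simp
  then show "(1 - poi_cdf l (Suc m)) / poi l (Suc m) \<le> (1 - poi_cdf l m) / poi l m"
    using poi_pos[OF assms] by (simp add: pos_divide_le_eq pos_le_divide_eq mult.commute)
qed


section \<open>A lower bound for the Poisson weight at the mode\<close>

lemma ln_fact_Suc: "ln (fact (Suc m)) = ln (real (Suc m)) + ln (fact m :: real)"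
  by (simp add: ln_mult)

text \<open>Equality at \<open>m = 1\<close> fixes the additive constant. The induction step is the
  midpoint bound for the integral of the convex function 1/x from \<open>m\<close> to
  \<open>m + 1\<close>.\<close>

lemma ln_fact_le_stirling:
  "1 \<le> m \<Longrightarrow> ln (fact m) \<le> (real m + 1/2) * ln m - m + 1"
proof (induction m rule: nat_induct_at_least)
  case base
  then show ?case by simp
next
  case (Suc m)
  have "2 * (real (Suc m) - real m) / (real m + real (Suc m)) \<le> ln (real (Suc m)) - ln (real m)"
    using Suc by (intro ln_inverse_approx_ge) auto
  then have "1 \<le> (real m + 1/2) * (ln (real (Suc m)) - ln (real m))"
    using Suc by (simp add: field_simps)
  then show ?case
    unfolding ln_fact_Suc using Suc.IH by (simp add: algebra_simps)
qed

text \<open>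
  The logarithm of the right-hand side is, for fixed $m = \lfloor l \rfloor$, concave in $l$, and at
  both $l = m$ and $l = m + 1$ it is bounded below by Stirling's formula.
\<close>
lemma poi_mode_ge:
  assumes "1 \<le> l"
  shows "exp (-1) \<le> sqrt l * poi l (nat \<lfloor>l\<rfloor>)"
proof -
  define m where "m = nat \<lfloor>l\<rfloor>"
  define t where "t = l - real m"
  \<comment> \<open>\<open>h j\<close> is the logarithm of \<open>sqrt l * poi l j\<close> at
    \<open>l = j\<close>, so Stirling's bound reads \<open>-1 <= h j\<close> for
    \<open>j >= 1\<close>.\<close>
  define h where "h j = (real j + 1/2) * ln j - j - ln (fact j)" for j
  have m: "1 \<le> m" "real m \<le> l" "l \<le> real (Suc m)"
    unfolding m_def using assms by linarith+
  have t: "0 \<le> t" "t \<le> 1" "l = (1 - t) * real m + t * real (Suc m)"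
    using m by (auto simp: t_def algebra_simps)
  have "(1 - t) * ln (real m) + t * ln (real (Suc m)) \<le> ln ((1 - t) *\<^sub>R real m + t *\<^sub>R real (Suc m))"
    using t m by (intro concave_onD[OF ln_concave]) auto
  then have "(1 - t) * ln (real m) + t * ln (real (Suc m)) \<le> ln l"
    using t by simp
  then have "(real m + 1/2) * ((1 - t) * ln (real m) + t * ln (real (Suc m))) \<le> (real m + 1/2) * ln l"
    by (intro mult_left_mono) auto
  \<comment> \<open>At \<open>l = m + 1\<close> the weights at \<open>m\<close> and
    \<open>m + 1\<close> agree, so \<open>h (Suc m)\<close> is also the logarithm of
    \<open>sqrt l * poi l m\<close> there. Both end points thus belong to the same function of
    \<open>l\<close>.\<close>
  moreover have h_Suc: "h (Suc m) = (real m + 1/2) * ln (Suc m) - Suc m - ln (fact m)"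
    unfolding h_def ln_fact_Suc by (simp add: algebra_simps)
  have "(1 - t) * h m + t * h (Suc m) = (real m + 1/2) * ((1 - t) * ln (real m) + t * ln (real (Suc m)))
      - (real m + t) - ln (fact m)"
    unfolding h_Suc h_def[of m] by (simp add: field_simps)
  ultimately have "(1 - t) * h m + t * h (Suc m) \<le> (real m + 1/2) * ln l - l - ln (fact m)"
    by (simp add: t_def)
  moreover have "(1 - t) * (-1) + t * (-1) \<le> (1 - t) * h m + t * h (Suc m)"
    using t m ln_fact_le_stirling[of m] ln_fact_le_stirling[of "Suc m"]
    by (intro add_mono mult_left_mono) (auto simp: h_def)
  ultimately have "exp (-1) \<le> exp ((real m + 1/2) * ln l - l - ln (fact m))"
    by simp
  also have "(real m + 1/2) * ln l - l - ln (fact m) = ln l / 2 + (- l + ln l * real m - ln (fact m))"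
    by (simp add: algebra_simps)
  also have "exp \<dots> = exp (ln l / 2) * (exp (- l) * exp (ln l * real m) / exp (ln (fact m)))"
    by (simp only: exp_add exp_diff)
  also have "\<dots> = sqrt l * poi l m"
    using assms by (simp add: poi_def exp_of_nat2_mult ln_sqrt[symmetric])
  finally show ?thesis by (simp add: m_def)
qed

text \<open>
  By monotonicity of the two ratios, the worst case is the mode.
\<close>
lemma cdf_tail_le_sqrt:
  assumes "1 \<le> l"
  shows "poi_cdf l m * (1 - poi_cdf l m) \<le> 3 * sqrt l * poi l m"
proof -
  define d where "d = nat \<lfloor>l\<rfloor>"
  have l: "0 < l" using assms by simp
  note p = poi_pos[OF l]
  have F: "0 \<le> poi_cdf l j" "poi_cdf l j \<le> 1" for j
    using poi_cdf_pos[OF l, of j] poi_cdf_le_1[OF l, of j] by auto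
  have "1 \<le> exp 1 * (sqrt l * poi l d)"
    using poi_mode_ge[OF assms] by (simp add: d_def exp_minus field_simps)
  \<comment> \<open>The constant 3 is e rounded up.\<close>
  also have "\<dots> \<le> 3 * (sqrt l * poi l d)"
    using exp_le p[of d] l by (intro mult_right_mono) (auto simp: less_imp_le)
  finally have "1 / poi l d \<le> 3 * sqrt l"
    using p[of d] by (simp add: field_simps)
  moreover have "poi_cdf l m * (1 - poi_cdf l m) / poi l m \<le> 1 / poi l d"
  proof (cases "m \<le> d")
    case True
    have "poi_cdf l m * (1 - poi_cdf l m) / poi l m \<le> poi_cdf l m * 1 / poi l m"
      using F p[of m] by (intro divide_right_mono mult_left_mono) (auto simp: less_imp_le)
    also have "\<dots> \<le> poi_cdf l d / poi l d"
      using monoD[OF cdf_div_poi_mono[OF l] True] by simp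
    also have "\<dots> \<le> 1 / poi l d"
      using F p[of d] by (intro divide_right_mono) (auto simp: less_imp_le)
    finally show ?thesis .
  next
    case False
    have "poi_cdf l m * (1 - poi_cdf l m) / poi l m \<le> 1 * (1 - poi_cdf l m) / poi l m"
      using F p[of m] by (intro divide_right_mono mult_right_mono) (auto simp: less_imp_le)
    also have "\<dots> \<le> (1 - poi_cdf l d) / poi l d"
      using antimonoD[OF tail_div_poi_antimono[OF l], of d m] False by simp
    also have "\<dots> \<le> 1 / poi l d"
      using F p[of d] by (intro divide_right_mono) (auto simp: less_imp_le)
    finally show ?thesis .
  qed
  ultimately have "poi_cdf l m * (1 - poi_cdf l m) / poi l m \<le> 3 * sqrt l"
    by simp
  then show ?thesis
    using p[of m] by (simp add: pos_divide_le_eq)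
qed

section \<open>The solution of the Stein equation and its bounds\<close>

definition poi_prob :: "real \<Rightarrow> nat set \<Rightarrow> real" where
  "poi_prob l A = measure (measure_pmf (poisson_pmf l)) A"

lemma poi_prob_finite: "0 < l \<Longrightarrow> finite A \<Longrightarrow> poi_prob l A = sum (poi l) A"
  unfolding poi_prob_def by (simp add: measure_measure_pmf_finite poi_def mult_ac)

lemma poi_prob_bounds:
  assumes "0 < l"
  shows "0 \<le> poi_prob l (A \<inter> {..m})" "poi_prob l (A \<inter> {..m}) \<le> poi_cdf l m"
    "0 \<le> poi_prob l (A - {..m})" "poi_prob l (A - {..m}) \<le> 1 - poi_cdf l m"
proof -
  have cdf: "poi_cdf l m = poi_prob l {..m}"
    using assms by (simp add: poi_prob_finite poi_cdf_def)
  show "poi_prob l (A \<inter> {..m}) \<le> poi_cdf l m"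
    unfolding cdf poi_prob_def by (intro measure_pmf.finite_measure_mono) auto
  have "poi_prob l (A - {..m}) \<le> poi_prob l (- {..m})"
    unfolding poi_prob_def by (intro measure_pmf.finite_measure_mono) auto
  also have "\<dots> = 1 - poi_cdf l m"
    unfolding cdf poi_prob_def using measure_pmf.prob_compl[of "{..m}" "poisson_pmf l"]
    by (simp add: Compl_eq_Diff_UNIV)
  finally show "poi_prob l (A - {..m}) \<le> 1 - poi_cdf l m" .
qed (simp_all add: poi_prob_def)

lemma poi_prob_split: "poi_prob l A = poi_prob l (A \<inter> {..m}) + poi_prob l (A - {..m})"
  unfolding poi_prob_def
  by (subst measure_pmf.finite_measure_Union[symmetric]) (auto intro!: arg_cong2[where f=measure])

text \<open>
  The value at \<open>0\<close> is arbitrary: the Stein equation multiplies it by \<open>0\<close>.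
\<close>
fun stein_sol :: "real \<Rightarrow> nat set \<Rightarrow> nat \<Rightarrow> real" where
  "stein_sol l A 0 = 0"
| "stein_sol l A (Suc m) =
     (poi_prob l (A \<inter> {..m}) - poi_prob l A * poi_cdf l m) / (l * poi l m)"

text \<open>Splitting \<open>poi_prob l A\<close> at \<open>m\<close> leaves two terms of opposite
  sign with nonnegative weights. The bounds on the solution and on its increments both start from
  this form.\<close>

lemma stein_sol_Suc:
  "stein_sol l A (Suc m) = (poi_prob l (A \<inter> {..m}) * (1 - poi_cdf l m)
     - poi_prob l (A - {..m}) * poi_cdf l m) / (l * poi l m)"
  by (simp add: poi_prob_split[of l A m] algebra_simps)

lemma poi_prob_step:
  assumes "0 < l"
  shows "poi_prob l (A \<inter> {..Suc m}) = poi_prob l (A \<inter> {..m}) + indicator A (Suc m) * poi l (Suc m)"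
proof (cases "Suc m \<in> A")
  case True
  then have "A \<inter> {..Suc m} = insert (Suc m) (A \<inter> {..m})" by auto
  then show ?thesis using True assms by (simp add: poi_prob_finite)
next
  case False
  then have "A \<inter> {..Suc m} = A \<inter> {..m}" by (auto simp: le_Suc_eq)
  then show ?thesis using False by simp
qed

text \<open>By \<open>poi_Suc\<close> both terms on the left have the denominator
  \<open>poi l j\<close>. Their numerators are partial sums of
  \<open>(indicator A i - poi_prob l A) * poi l i\<close>, up to \<open>j\<close> and up to
  \<open>j - 1\<close>, so only the term at \<open>i = j\<close> survives.\<close>

lemma stein_sol_eq:
  assumes "0 < l"
  shows "l * stein_sol l A (Suc j) - real j * stein_sol l A j = indicator A j - poi_prob l A"
proof -
  note p = poi_pos[OF assms]
  show ?thesis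
  proof (cases j)
    case 0
    have "A \<inter> {..0} = (if 0 \<in> A then {0} else {})" by auto
    then have "poi_prob l (A \<inter> {..0}) = indicator A 0 * poi l 0"
      using assms by (simp add: poi_prob_finite)
    then show ?thesis
      using 0 assms p[of 0] by (simp add: poi_cdf_def field_simps)
  next
    case (Suc m)
    have "stein_sol l A j = (poi_prob l (A \<inter> {..m}) - poi_prob l A * poi_cdf l m) / (real j * poi l j)"
      by (simp only: Suc stein_sol.simps poi_Suc)
    then have "real j * stein_sol l A j = (poi_prob l (A \<inter> {..m}) - poi_prob l A * poi_cdf l m) / poi l j"
      using Suc by (simp del: of_nat_Suc stein_sol.simps)
    moreover have "l * stein_sol l A (Suc j) = (poi_prob l (A \<inter> {..j}) - poi_prob l A * poi_cdf l j) / poi l j"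
      using assms by simp
    ultimately have "l * stein_sol l A (Suc j) - real j * stein_sol l A j
      = (indicator A j * poi l j - poi_prob l A * poi l j) / poi l j"
      using poi_prob_step[OF assms, of A m] poi_cdf_Suc[of l m] Suc
      by (simp add: algebra_simps flip: diff_divide_distrib)
    also have "\<dots> = indicator A j - poi_prob l A"
      using p[of j] by (simp add: field_simps)
    finally show ?thesis .
  qed
qed

text \<open>The two terms of the numerator in \<open>stein_sol_Suc\<close> both lie between 0 and
  F(1 - F), where F is \<open>poi_cdf l m\<close>, so their difference is at most that in
  modulus.\<close>

lemma abs_stein_sol_le:
  assumes "0 < l"
  shows "\<bar>stein_sol l A (Suc m)\<bar> \<le> poi_cdf l m * (1 - poi_cdf l m) / (l * poi l m)"
proof -
  note b = poi_prob_bounds[OF assms, of A m]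
  have "poi_prob l (A \<inter> {..m}) * (1 - poi_cdf l m) \<le> poi_cdf l m * (1 - poi_cdf l m)"
    using b by (intro mult_right_mono) auto
  moreover have "poi_prob l (A - {..m}) * poi_cdf l m \<le> (1 - poi_cdf l m) * poi_cdf l m"
    using b by (intro mult_right_mono) auto
  moreover have "0 \<le> poi_prob l (A \<inter> {..m}) * (1 - poi_cdf l m)" "0 \<le> poi_prob l (A - {..m}) * poi_cdf l m"
    using b by auto
  ultimately have "\<bar>poi_prob l (A \<inter> {..m}) * (1 - poi_cdf l m) - poi_prob l (A - {..m}) * poi_cdf l m\<bar>
    \<le> poi_cdf l m * (1 - poi_cdf l m)"
    by (simp add: mult.commute)
  then show ?thesis
    unfolding stein_sol_Suc using assms poi_pos[OF assms, of m]
    by (simp add: abs_mult divide_right_mono)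
qed

lemma stein_sol_bound_1:
  assumes "0 < l"
  shows "\<bar>stein_sol l A (Suc m)\<bar> \<le> 1"
  using abs_stein_sol_le[OF assms, of A m] cdf_tail_le[OF assms, of m] poi_pos[OF assms, of m] assms
  by (simp add: divide_le_eq order.trans)

lemma stein_sol_bound_sqrt:
  assumes "1 \<le> l"
  shows "\<bar>stein_sol l A (Suc m)\<bar> \<le> 3 / sqrt l"
proof -
  have l: "0 < l" using assms by simp
  have "\<bar>stein_sol l A (Suc m)\<bar> \<le> 3 * sqrt l * poi l m / (l * poi l m)"
    using poi_pos[OF l, of m] l
    by (intro order.trans[OF abs_stein_sol_le[OF l]] divide_right_mono cdf_tail_le_sqrt assms)
      (simp add: less_imp_le)
  also have "\<dots> = 3 / sqrt l"
    using poi_pos[OF l, of m] l by (simp add: field_simps)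
  finally show ?thesis .
qed

text \<open>
  In the increment, only the mass at \<open>Suc m\<close> contributes positively. The lower bound comes
  from applying this to the complement of \<open>A\<close>.
\<close>
lemma stein_sol_diff_le:
  assumes "0 < l"
  shows "stein_sol l A (Suc (Suc m)) - stein_sol l A (Suc m) \<le> (1 - exp (- l)) / l"
proof -
  note p = poi_pos[OF assms]
  define a where "a = poi_prob l (A \<inter> {..m})"
  define t where "t = poi_prob l (A - {..Suc m})"
  define e where "e = indicator A (Suc m) * poi l (Suc m)"
  define \<alpha> where "\<alpha> j = (1 - poi_cdf l j) / poi l j" for j
  define \<beta> where "\<beta> j = poi_cdf l j / poi l j" for j
  have e: "0 \<le> e" "e \<le> poi l (Suc m)"
    using p[of "Suc m"] by (auto simp: e_def indicator_def)
  have s1: "poi_prob l (A \<inter> {..Suc m}) = a + e"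
    using poi_prob_step[OF assms] by (simp add: a_def e_def)
  have s2: "poi_prob l (A - {..m}) = t + e"
    using poi_prob_split[of l A m] poi_prob_split[of l A "Suc m"] s1 by (simp add: a_def t_def)
  have nonneg: "0 \<le> a" "0 \<le> t"
    using poi_prob_bounds[OF assms] by (auto simp: a_def t_def)
  have mono: "\<alpha> (Suc m) \<le> \<alpha> m" "\<beta> m \<le> \<beta> (Suc m)"
    using antimonoD[OF tail_div_poi_antimono[OF assms], of m "Suc m"]
      monoD[OF cdf_div_poi_mono[OF assms], of m "Suc m"] by (auto simp: \<alpha>_def \<beta>_def)
  have pos: "0 \<le> \<alpha> (Suc m)" "0 \<le> \<beta> m"
    using poi_cdf_le_1[OF assms] poi_cdf_pos[OF assms] p
    by (auto simp: \<alpha>_def \<beta>_def less_imp_le)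
  have form: "l * stein_sol l A (Suc j) = poi_prob l (A \<inter> {..j}) * \<alpha> j - poi_prob l (A - {..j}) * \<beta> j" for j
    unfolding stein_sol_Suc \<alpha>_def \<beta>_def using assms p[of j] by (simp add: field_simps)
  \<comment> \<open>Mass away from \<open>Suc m\<close> stays on its side when the cut moves from
    \<open>m\<close> to \<open>Suc m\<close>, so \<open>a\<close> and \<open>t\<close> meet only
    differences of the monotone ratios.\<close>
  have "l * (stein_sol l A (Suc (Suc m)) - stein_sol l A (Suc m))
     = e * (\<alpha> (Suc m) + \<beta> m) - a * (\<alpha> m - \<alpha> (Suc m)) - t * (\<beta> (Suc m) - \<beta> m)"
    unfolding right_diff_distrib form s1 s2 a_def[symmetric] t_def[symmetric]
    by (simp add: algebra_simps)
  also have "\<dots> \<le> e * (\<alpha> (Suc m) + \<beta> m)"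
    using mult_nonneg_nonneg[OF nonneg(1), of "\<alpha> m - \<alpha> (Suc m)"]
      mult_nonneg_nonneg[OF nonneg(2), of "\<beta> (Suc m) - \<beta> m"] mono by linarith
  also have "\<dots> \<le> poi l (Suc m) * (\<alpha> (Suc m) + \<beta> m)"
    using e pos by (intro mult_right_mono) auto
  also have "\<dots> = 1 - poi_cdf l (Suc m) + l * poi_cdf l m / real (Suc m)"
  proof -
    have pS: "poi l (Suc m) = l * poi l m / real (Suc m)"
      using poi_Suc[of m l] by (simp add: field_simps del: of_nat_Suc)
    have "poi l (Suc m) * \<beta> m = l * poi_cdf l m / real (Suc m)"
      unfolding pS \<beta>_def using p[of m] by (simp del: of_nat_Suc)
    moreover have "poi l (Suc m) * \<alpha> (Suc m) = 1 - poi_cdf l (Suc m)"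
      using p[of "Suc m"] by (simp add: \<alpha>_def)
    ultimately show ?thesis by (simp add: distrib_left)
  qed
  \<comment> \<open>\<open>poi_cdf_ratio\<close> bounds the last term by
    \<open>poi_cdf l (Suc m) - exp (- l)\<close>, and \<open>poi_cdf l (Suc m)\<close>
    cancels.\<close>
  also have "\<dots> \<le> 1 - exp (- l)"
    using poi_cdf_ratio[OF assms, of m] by (simp add: field_simps del: of_nat_Suc)
  finally show ?thesis
    using assms by (simp add: field_simps)
qed

lemma stein_sol_compl:
  assumes "0 < l"
  shows "stein_sol l (- A) j = - stein_sol l A j"
proof (cases j)
  case (Suc m)
  have compl: "poi_prob l (- A) = 1 - poi_prob l A"
    using measure_pmf.prob_compl[of A "poisson_pmf l"]
    by (simp add: poi_prob_def Compl_eq_Diff_UNIV)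
  have "poi_prob l (- A \<inter> {..m}) + poi_prob l (A \<inter> {..m}) = poi_prob l {..m}"
    unfolding poi_prob_def
    by (subst measure_pmf.finite_measure_Union[symmetric]) (auto intro!: arg_cong2[where f=measure])
  also have "\<dots> = poi_cdf l m"
    using assms by (simp add: poi_prob_finite poi_cdf_def)
  finally have initial: "poi_prob l (- A \<inter> {..m}) = poi_cdf l m - poi_prob l (A \<inter> {..m})"
    by simp
  have "poi_prob l (- A \<inter> {..m}) - poi_prob l (- A) * poi_cdf l m
      = - (poi_prob l (A \<inter> {..m}) - poi_prob l A * poi_cdf l m)"
    unfolding compl initial by (simp add: algebra_simps)
  then show ?thesis
    unfolding Suc stein_sol.simps by (simp only: minus_divide_left)
qed simp

text \<open>\<open>1 <= i\<close> keeps away from the arbitrary value at \<open>0\<close>. Gaps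
  beyond 1 are allowed because the box count plus one can exceed the count after moving a ball by
  2.\<close>

lemma stein_sol_lipschitz:
  assumes "0 < l" "1 \<le> i" "i \<le> j"
  shows "\<bar>stein_sol l A j - stein_sol l A i\<bar> \<le> min 1 (1 / l) * real (j - i)"
  using assms(3)
proof (induction j rule: dec_induct)
  case (step j)
  then obtain m where m: "j = Suc m" using assms(2) by (cases j) auto
  have "(1 - exp (- l)) / l \<le> min 1 (1 / l)"
    using assms(1) exp_ge_add_one_self[of "- l"] by (simp add: divide_le_eq)
  then have "\<bar>stein_sol l A (Suc j) - stein_sol l A j\<bar> \<le> min 1 (1 / l)"
    using stein_sol_diff_le[OF assms(1), of A m] stein_sol_diff_le[OF assms(1), of "- A" m]
    unfolding m stein_sol_compl[OF assms(1)] by linarith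
  moreover have "min 1 (1 / l) * real (Suc j - i) = min 1 (1 / l) * real (j - i) + min 1 (1 / l)"
    using step by (simp add: Suc_diff_le algebra_simps)
  ultimately show ?case using step.IH by linarith
qed simp

section \<open>Coincidences among uniformly placed balls\<close>

text \<open>A finite sum in place of an expectation keeps the combinatorics free of measure theory
  until \<open>multi_boxes_law\<close>. Placements are extensional functions, so each is counted
  once.\<close>

definition unif_avg :: "nat \<Rightarrow> nat \<Rightarrow> ((nat \<Rightarrow> nat) \<Rightarrow> real) \<Rightarrow> real" where
  "unif_avg n k h = (\<Sum>x\<in>{..<k} \<rightarrow>\<^sub>E {..<n}. h x) / real n ^ k"

lemma unif_avg_add: "unif_avg n k (\<lambda>x. g x + h x) = unif_avg n k g + unif_avg n k h"
  by (simp add: unif_avg_def sum.distrib add_divide_distrib)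

lemma unif_avg_diff: "unif_avg n k (\<lambda>x. g x - h x) = unif_avg n k g - unif_avg n k h"
  by (simp add: unif_avg_def sum_subtractf diff_divide_distrib)

lemma unif_avg_cmult: "unif_avg n k (\<lambda>x. c * h x) = c * unif_avg n k h"
  by (simp add: unif_avg_def sum_distrib_left)

lemma unif_avg_sum: "unif_avg n k (\<lambda>x. \<Sum>i\<in>I. h i x) = (\<Sum>i\<in>I. unif_avg n k (h i))"
  by (simp add: unif_avg_def sum.swap[of _ I] sum_divide_distrib)

lemma unif_avg_const: "1 \<le> n \<Longrightarrow> unif_avg n k (\<lambda>_. c) = c"
  by (simp add: unif_avg_def card_PiE)

lemma unif_avg_mono:
  "(\<And>x. x \<in> {..<k} \<rightarrow>\<^sub>E {..<n} \<Longrightarrow> g x \<le> h x) \<Longrightarrow> unif_avg n k g \<le> unif_avg n k h"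
  unfolding unif_avg_def by (intro divide_right_mono sum_mono) auto

lemma unif_avg_cong:
  "(\<And>x. x \<in> {..<k} \<rightarrow>\<^sub>E {..<n} \<Longrightarrow> g x = h x) \<Longrightarrow> unif_avg n k g = unif_avg n k h"
  unfolding unif_avg_def by (simp cong: sum.cong)

lemma unif_avg_abs: "\<bar>unif_avg n k h\<bar> \<le> unif_avg n k (\<lambda>x. \<bar>h x\<bar>)"
  unfolding unif_avg_def by (simp add: divide_right_mono)

text \<open>Conditioning on a collision is the map \<open>x(j := x i)\<close>. It sends all
  placements onto the colliding ones, and each fibre has \<open>n\<close> elements because only the
  old box of ball \<open>j\<close> is forgotten.\<close>

lemma unif_avg_collision:
  assumes "i < k" "j < k" "i \<noteq> j" "1 \<le> n"
  shows "unif_avg n k (\<lambda>x. if x i = x j then h x else 0) = unif_avg n k (\<lambda>x. h (x(j := x i))) / real n"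
proof -
  let ?P = "{..<k} \<rightarrow>\<^sub>E {..<n}" and ?m = "\<lambda>x. x(j := x i)"
  let ?D = "{x \<in> ?P. x i = x j}"
  have fin: "finite ?P" by (intro finite_PiE) auto
  have maps: "?m ` ?P \<subseteq> ?D"
    using assms by (auto simp: PiE_def Pi_def extensional_def)
  have fibre: "card {x \<in> ?P. ?m x = y} = n" if y: "y \<in> ?D" for y
  proof -
    have "bij_betw (\<lambda>b. y(j := b)) {..<n} {x \<in> ?P. ?m x = y}"
    proof (rule bij_betwI[where g = "\<lambda>x. x j"])
      show "(\<lambda>b. y(j := b)) \<in> {..<n} \<rightarrow> {x \<in> ?P. ?m x = y}"
        using y assms by (auto simp: PiE_def Pi_def extensional_def fun_eq_iff)
      show "(\<lambda>x. x j) \<in> {x \<in> ?P. ?m x = y} \<rightarrow> {..<n}"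
        using assms by (auto simp: PiE_def Pi_def)
      show "(y(j := b)) j = b" for b by simp
      show "y(j := x j) = x" if "x \<in> {x \<in> ?P. ?m x = y}" for x
      proof -
        from that have "y = ?m x" by simp
        then show ?thesis by (simp only: fun_upd_upd fun_upd_triv)
      qed
    qed
    then show ?thesis using bij_betw_same_card by fastforce
  qed
  have "(\<Sum>x\<in>?P. h (?m x)) = (\<Sum>y\<in>?D. \<Sum>x | x \<in> ?P \<and> ?m x = y. h (?m x))"
    using sum.group[OF fin _ maps, of "\<lambda>x. h (?m x)"] fin by simp
  also have "\<dots> = (\<Sum>y\<in>?D. real n * h y)"
    by (intro sum.cong refl) (simp add: fibre)
  also have "\<dots> = real n * (\<Sum>x\<in>?P. if x i = x j then h x else 0)"
    using fin by (simp add: sum_distrib_left[symmetric] sum.inter_filter)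
  finally show ?thesis
    using assms by (simp add: unif_avg_def)
qed

lemma unif_avg_pair:
  assumes "i < k" "j < k" "i \<noteq> j" "1 \<le> n"
  shows "unif_avg n k (\<lambda>x. of_bool (x i = x j)) = 1 / real n"
  using unif_avg_collision[OF assms, of "\<lambda>_. 1"] unif_avg_const[OF assms(4), of k 1]
  by (simp add: of_bool_def)

text \<open>Moving ball \<open>j\<close> does not touch the coincidence of \<open>i\<close> and
  \<open>l\<close>, so the pair probability applies a second time.\<close>

lemma unif_avg_triple:
  assumes "i < k" "j < k" "l < k" "i \<noteq> j" "l \<noteq> i" "l \<noteq> j" "1 \<le> n"
  shows "unif_avg n k (\<lambda>x. of_bool (x i = x j) * of_bool (x i = x l)) = 1 / (real n)\<^sup>2"
proof -
  have "unif_avg n k (\<lambda>x. of_bool (x i = x j) * of_bool (x i = x l))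
      = unif_avg n k (\<lambda>x. if x i = x j then of_bool (x i = x l) else 0)"
    by (rule unif_avg_cong) auto
  also have "\<dots> = unif_avg n k (\<lambda>x. of_bool (x i = x l)) / real n"
    using assms by (subst unif_avg_collision) auto
  also have "\<dots> = 1 / (real n)\<^sup>2"
    using assms by (simp add: unif_avg_pair power2_eq_square)
  finally show ?thesis .
qed

section \<open>Counting coinciding pairs and triples box by box\<close>

lemma sum_pairs:
  fixes f :: "nat \<Rightarrow> real"
  assumes "finite I" "\<And>i. f i * f i = f i"
  shows "(\<Sum>i\<in>I. \<Sum>j\<in>I - {i}. f i * f j) = sum f I * (sum f I - 1)"
proof -
  have "(\<Sum>i\<in>I. \<Sum>j\<in>I - {i}. f i * f j) = (\<Sum>i\<in>I. f i * (sum f I - 1))"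
  proof (intro sum.cong refl)
    fix i assume "i \<in> I"
    then have "(\<Sum>j\<in>I - {i}. f i * f j) = f i * (sum f I - f i)"
      using assms(1) by (simp add: sum_diff1 flip: sum_distrib_left)
    \<comment> \<open>Idempotence makes \<open>f i\<close> a 0-1 value, for which
      \<open>f i * (sum f I - f i)\<close> is \<open>f i * (sum f I - 1)\<close>. Summation over
      \<open>i\<close> then gives a falling factorial.\<close>
    then show "(\<Sum>j\<in>I - {i}. f i * f j) = f i * (sum f I - 1)"
      using assms(2)[of i] by (simp add: algebra_simps)
  qed
  then show ?thesis by (simp add: sum_distrib_right)
qed

lemma sum_triples:
  fixes f :: "nat \<Rightarrow> real"
  assumes "finite I" "\<And>i. f i * f i = f i"
  shows "(\<Sum>i\<in>I. \<Sum>j\<in>I - {i}. \<Sum>l\<in>I - {i, j}. f i * f j * f l)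
    = sum f I * (sum f I - 1) * (sum f I - 2)"
proof -
  have "(\<Sum>i\<in>I. \<Sum>j\<in>I - {i}. \<Sum>l\<in>I - {i, j}. f i * f j * f l)
      = (\<Sum>i\<in>I. \<Sum>j\<in>I - {i}. f i * f j * (sum f I - 2))"
  proof (intro sum.cong refl)
    fix i j assume ij: "i \<in> I" "j \<in> I - {i}"
    have "sum f (I - {i, j}) = sum f I - f i - f j"
      using ij assms(1) by (simp add: sum_diff1 Diff_insert2[of I i "{j}"])
    then have "(\<Sum>l\<in>I - {i, j}. f i * f j * f l) = f i * f j * (sum f I - f i - f j)"
      by (simp flip: sum_distrib_left)
    also have "\<dots> = f i * f j * sum f I - (f i * f i) * f j - f i * (f j * f j)"
      by (simp add: algebra_simps)
    finally show "(\<Sum>l\<in>I - {i, j}. f i * f j * f l) = f i * f j * (sum f I - 2)"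
      by (simp add: assms(2) algebra_simps)
  qed
  also have "\<dots> = sum f I * (sum f I - 1) * (sum f I - 2)"
    using sum_pairs[OF assms] by (simp flip: sum_distrib_right)
  finally show ?thesis .
qed

text \<open>
  Ordered pairs and ordered triples of distinct balls, so every unordered pair counts twice and every
  unordered triple six times.
\<close>
definition coll_pairs :: "nat \<Rightarrow> (nat \<Rightarrow> nat) \<Rightarrow> real" where
  "coll_pairs k x = (\<Sum>i<k. \<Sum>j\<in>{..<k} - {i}. of_bool (x i = x j))"

definition coll_triples :: "nat \<Rightarrow> (nat \<Rightarrow> nat) \<Rightarrow> real" where
  "coll_triples k x = (\<Sum>i<k. \<Sum>j\<in>{..<k} - {i}. \<Sum>l\<in>{..<k} - {i, j}.
     of_bool (x i = x j) * of_bool (x i = x l))"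

lemma card_filter_eq_sum:
  assumes "finite A"
  shows "real (card {a\<in>A. P a}) = (\<Sum>a\<in>A. of_bool (P a))"
proof -
  have "real (card {a\<in>A. P a}) = (\<Sum>a\<in>{a\<in>A. P a}. 1)" by simp
  also have "\<dots> = (\<Sum>a\<in>A. of_bool (P a))"
    unfolding of_bool_def using assms by (rule sum.inter_filter)
  finally show ?thesis .
qed

text \<open>A coincidence is detected by summing over all boxes the event that both balls lie there:
  only the box \<open>x i\<close> can contribute, and it is in range. After exchanging the sums,
  each box yields a falling factorial of its occupancy.\<close>

lemma coll_pairs_by_box:
  assumes "x \<in> {..<k} \<rightarrow>\<^sub>E {..<n}"
  shows "coll_pairs k x = (\<Sum>b<n. let N = real (card {i\<in>{..<k}. x i = b}) in N * (N - 1))"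
proof -
  have "(\<Sum>b<n. let N = real (card {i\<in>{..<k}. x i = b}) in N * (N - 1))
    = (\<Sum>b<n. \<Sum>i<k. \<Sum>j\<in>{..<k} - {i}. of_bool (x i = b) * of_bool (x j = b))"
    unfolding Let_def card_filter_eq_sum[OF finite_lessThan] by (subst sum_pairs) auto
  also have "\<dots> = (\<Sum>i<k. \<Sum>j\<in>{..<k} - {i}. \<Sum>b<n. of_bool (x i = b) * of_bool (x j = b))"
    by (subst sum.swap, rule sum.cong[OF refl], subst sum.swap, rule refl)
  also have "\<dots> = (\<Sum>i<k. \<Sum>j\<in>{..<k} - {i}. of_bool (x i = x j))"
  proof (intro sum.cong refl)
    fix i j assume "i \<in> {..<k}" "j \<in> {..<k} - {i}"
    then have "x i \<in> {..<n}" using assms by auto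
    then have "(\<Sum>b<n. of_bool (x i = b) * of_bool (x j = b)) = (\<Sum>b<n. if b = x i then of_bool (x i = x j) else (0::real))"
      by (intro sum.cong) auto
    then show "(\<Sum>b<n. of_bool (x i = b) * of_bool (x j = b)) = (of_bool (x i = x j) :: real)"
      using \<open>x i \<in> {..<n}\<close> by simp
  qed
  finally show ?thesis by (simp add: coll_pairs_def)
qed

lemma coll_triples_by_box:
  assumes "x \<in> {..<k} \<rightarrow>\<^sub>E {..<n}"
  shows "coll_triples k x = (\<Sum>b<n. let N = real (card {i\<in>{..<k}. x i = b}) in N * (N - 1) * (N - 2))"
proof -
  have "(\<Sum>b<n. let N = real (card {i\<in>{..<k}. x i = b}) in N * (N - 1) * (N - 2))
    = (\<Sum>b<n. \<Sum>i<k. \<Sum>j\<in>{..<k} - {i}. \<Sum>l\<in>{..<k} - {i, j}.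
        of_bool (x i = b) * of_bool (x j = b) * of_bool (x l = b))"
    unfolding Let_def card_filter_eq_sum[OF finite_lessThan] by (subst sum_triples) auto
  also have "\<dots> = (\<Sum>i<k. \<Sum>j\<in>{..<k} - {i}. \<Sum>l\<in>{..<k} - {i, j}. \<Sum>b<n.
        of_bool (x i = b) * of_bool (x j = b) * of_bool (x l = b))"
    by (subst sum.swap, rule sum.cong[OF refl], subst sum.swap, rule sum.cong[OF refl], subst sum.swap, rule refl)
  also have "\<dots> = (\<Sum>i<k. \<Sum>j\<in>{..<k} - {i}. \<Sum>l\<in>{..<k} - {i, j}. of_bool (x i = x j) * of_bool (x i = x l))"
  proof (intro sum.cong refl)
    fix i j l assume "i \<in> {..<k}"
    then have "x i \<in> {..<n}" using assms by auto
    have "(\<Sum>b<n. of_bool (x i = b) * of_bool (x j = b) * of_bool (x l = b))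
        = (\<Sum>b<n. if b = x i then of_bool (x i = x j) * of_bool (x i = x l) else (0::real))"
      by (intro sum.cong) auto
    then show "(\<Sum>b<n. of_bool (x i = b) * of_bool (x j = b) * of_bool (x l = b))
        = (of_bool (x i = x j) * of_bool (x i = x l) :: real)"
      using \<open>x i \<in> {..<n}\<close> by simp
  qed
  finally show ?thesis by (simp add: coll_triples_def)
qed

lemma multi_boxes_sum:
  "real (multi_boxes n k x) = (\<Sum>b<n. of_bool (2 \<le> card {i\<in>{..<k}. x i = b}))"
  unfolding multi_boxes_def by (rule card_filter_eq_sum) simp

lemma pairs_minus_boxes:
  assumes "x \<in> {..<k} \<rightarrow>\<^sub>E {..<n}"
  shows "real (multi_boxes n k x) \<le> coll_pairs k x / 2"
    "coll_pairs k x / 2 - real (multi_boxes n k x) \<le> coll_triples k x / 3"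
proof -
  have 1: "of_bool (2 \<le> N) \<le> real N * (real N - 1) / 2" for N :: nat
  proof (cases "2 \<le> N")
    case True
    then have "2 * 1 \<le> real N * (real N - 1)" by (intro mult_mono) auto
    then show ?thesis using True by simp
  next
    case False
    then have "N = 0 \<or> N = 1" by auto
    then show ?thesis by auto
  qed
  have 2: "real N * (real N - 1) / 2 - of_bool (2 \<le> N) \<le> real N * (real N - 1) * (real N - 2) / 3" for N :: nat
  proof -
    consider "N = 0" | "N = 1" | "N = 2" | "N = 3" | "4 \<le> N" by linarith
    then show ?thesis
    proof cases
      case 5
      then have "real N * (real N - 1) * (1 / 2) \<le> real N * (real N - 1) * ((real N - 2) / 3)"
        by (intro mult_left_mono) auto
      then have "real N * (real N - 1) / 2 \<le> real N * (real N - 1) * (real N - 2) / 3"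
        by (simp only: times_divide_eq_right mult_1_right)
      moreover have "0 \<le> (of_bool (2 \<le> N) :: real)" by simp
      ultimately show ?thesis by linarith
    qed auto
  qed
  show "real (multi_boxes n k x) \<le> coll_pairs k x / 2"
    unfolding multi_boxes_sum coll_pairs_by_box[OF assms] Let_def sum_divide_distrib
    by (intro sum_mono 1)
  show "coll_pairs k x / 2 - real (multi_boxes n k x) \<le> coll_triples k x / 3"
    unfolding multi_boxes_sum coll_pairs_by_box[OF assms] coll_triples_by_box[OF assms] Let_def
      sum_divide_distrib sum_subtractf[symmetric]
    by (intro sum_mono 2)
qed

section \<open>The effect of moving one ball\<close>

lemma multi_boxes_upd:
  fixes x :: "nat \<Rightarrow> nat"
  assumes "j < k" "a < n"
  defines "N \<equiv> \<lambda>b. card {i\<in>{..<k} - {j}. x i = b}"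
  shows "multi_boxes n k (x(j := a)) = card {b\<in>{..<n}. 2 \<le> N b} + of_bool (N a = 1)"
proof -
  \<comment> \<open>\<open>N\<close> counts the other balls only, so the new position of
    \<open>j\<close> enters through box \<open>a\<close> alone. A new multiple box arises exactly
    when \<open>a\<close> goes from one ball to two.\<close>
  have N: "card {i\<in>{..<k}. (x(j := a)) i = b} = N b + of_bool (b = a)" for b
  proof (cases "b = a")
    case True
    have "{i\<in>{..<k}. (x(j := a)) i = b} = insert j {i\<in>{..<k} - {j}. x i = b}"
      using assms True by auto
    then show ?thesis using True by (simp add: N_def)
  next
    case False
    then have "{i\<in>{..<k}. (x(j := a)) i = b} = {i\<in>{..<k} - {j}. x i = b}" by auto
    then show ?thesis using False by (simp add: N_def)
  qed
  show ?thesis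
  proof (cases "N a = 1")
    case True
    have "{b\<in>{..<n}. 2 \<le> N b + of_bool (b = a)} = insert a {b\<in>{..<n}. 2 \<le> N b}"
      using assms(2) True by auto
    then show ?thesis unfolding multi_boxes_def N using True by simp
  next
    case False
    have "{b\<in>{..<n}. 2 \<le> N b + of_bool (b = a)} = {b\<in>{..<n}. 2 \<le> N b}"
      using False by (auto simp: of_bool_def split: if_splits)
    then show ?thesis unfolding multi_boxes_def N using False by simp
  qed
qed

text \<open>By \<open>multi_boxes_upd\<close> both counts are \<open>U\<close>, which leaves out
  ball \<open>j\<close>, plus one indicator. The first two claims meet the hypotheses of
  \<open>stein_sol_lipschitz\<close> and make the natural subtraction in the third a true
  difference.\<close>

lemma multi_boxes_collide:
  assumes x: "x \<in> {..<k} \<rightarrow>\<^sub>E {..<n}" and ij: "i < k" "j < k" "i \<noteq> j"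
  shows "1 \<le> multi_boxes n k (x(j := x i))"
    "multi_boxes n k (x(j := x i)) \<le> multi_boxes n k x + 1"
    "real (multi_boxes n k x + 1 - multi_boxes n k (x(j := x i))) \<le>
      (\<Sum>l\<in>{..<k} - {i, j}. of_bool (x l = x i)) + (\<Sum>l\<in>{..<k} - {j}. of_bool (x l = x j))"
proof -
  define N where "N b = card {l\<in>{..<k} - {j}. x l = b}" for b
  define U where "U = card {b\<in>{..<n}. 2 \<le> N b}"
  have lt: "x i < n" "x j < n" using x ij by auto
  have W': "multi_boxes n k (x(j := x i)) = U + of_bool (N (x i) = 1)"
    using multi_boxes_upd[OF ij(2) lt(1), of x] by (simp add: U_def N_def)
  have W: "multi_boxes n k x = U + of_bool (N (x j) = 1)"
    using multi_boxes_upd[OF ij(2) lt(2), of x] by (simp add: U_def N_def)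
  have "{l\<in>{..<k} - {j}. x l = x i} = insert i {l\<in>{..<k} - {i, j}. x l = x i}"
    using ij by auto
  then have Na: "N (x i) = Suc (card {l\<in>{..<k} - {i, j}. x l = x i})"
    by (simp add: N_def)
  show "1 \<le> multi_boxes n k (x(j := x i))"
  proof (cases "N (x i) = 1")
    case False
    then have "2 \<le> N (x i)" using Na by linarith
    then have "x i \<in> {b\<in>{..<n}. 2 \<le> N b}" using lt by simp
    then have "U \<noteq> 0" unfolding U_def by (subst card_0_eq) auto
    then show ?thesis by (simp add: W')
  qed (simp add: W')
  show "multi_boxes n k (x(j := x i)) \<le> multi_boxes n k x + 1"
    by (simp add: W W')
  have N_pos: "1 \<le> N (x i)" using Na by simp
  \<comment> \<open>The gap is \<open>of_bool (N (x j) = 1)\<close> plus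
    \<open>of_bool (N (x i) > 1)\<close>. The 1 subtracted from \<open>N (x i)\<close> is ball
    \<open>i\<close> itself.\<close>
  have "multi_boxes n k x + 1 - multi_boxes n k (x(j := x i)) \<le> (N (x i) - 1) + N (x j)"
    using N_pos by (auto simp: W W' of_bool_def)
  then have "real (multi_boxes n k x + 1 - multi_boxes n k (x(j := x i)))
      \<le> real (N (x i) - 1) + real (N (x j))" by linarith
  also have "\<dots> = (\<Sum>l\<in>{..<k} - {i, j}. of_bool (x l = x i)) + (\<Sum>l\<in>{..<k} - {j}. of_bool (x l = x j))"
    unfolding Na diff_Suc_1 N_def[of "x j"] by (simp only: card_filter_eq_sum finite_Diff finite_lessThan)
  finally show "real (multi_boxes n k x + 1 - multi_boxes n k (x(j := x i))) \<le>
      (\<Sum>l\<in>{..<k} - {i, j}. of_bool (x l = x i)) + (\<Sum>l\<in>{..<k} - {j}. of_bool (x l = x j))" .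
qed

section \<open>Poisson approximation\<close>

text \<open>A size-bias identity: each pair collides with probability \<open>1 / n\<close>, and the
  conditioned placement is coupled to \<open>x\<close> by moving ball \<open>j\<close>.\<close>

lemma unif_avg_coll_pairs_mult:
  assumes "1 \<le> n"
  shows "unif_avg n k (\<lambda>x. coll_pairs k x * h x)
    = (\<Sum>i<k. \<Sum>j\<in>{..<k} - {i}. unif_avg n k (\<lambda>x. h (x(j := x i)))) / real n"
proof -
  have "unif_avg n k (\<lambda>x. coll_pairs k x * h x)
      = unif_avg n k (\<lambda>x. \<Sum>i<k. \<Sum>j\<in>{..<k} - {i}. if x i = x j then h x else 0)"
    unfolding coll_pairs_def sum_distrib_right by (intro unif_avg_cong sum.cong) auto
  also have "\<dots> = (\<Sum>i<k. \<Sum>j\<in>{..<k} - {i}. unif_avg n k (\<lambda>x. if x i = x j then h x else 0))"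
    by (simp add: unif_avg_sum)
  also have "\<dots> = (\<Sum>i<k. \<Sum>j\<in>{..<k} - {i}. unif_avg n k (\<lambda>x. h (x(j := x i))) / real n)"
    using assms by (intro sum.cong refl unif_avg_collision) auto
  finally show ?thesis by (simp add: sum_divide_distrib)
qed

lemma unif_avg_coll_triples:
  assumes "1 \<le> n"
  shows "unif_avg n k (coll_triples k) \<le> real k ^ 3 / (real n)\<^sup>2"
proof -
  have "unif_avg n k (coll_triples k) = (\<Sum>i<k. \<Sum>j\<in>{..<k} - {i}. \<Sum>l\<in>{..<k} - {i, j}.
      unif_avg n k (\<lambda>x. of_bool (x i = x j) * of_bool (x i = x l)))"
    unfolding coll_triples_def[abs_def] by (simp only: unif_avg_sum)
  also have "\<dots> = (\<Sum>i<k. \<Sum>j\<in>{..<k} - {i}. \<Sum>l\<in>{..<k} - {i, j}. 1 / (real n)\<^sup>2)"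
    using assms by (intro sum.cong refl unif_avg_triple) auto
  also have "\<dots> \<le> (\<Sum>i<k. \<Sum>j<k. \<Sum>l<k. 1 / (real n)\<^sup>2)"
    by (intro sum_mono order.trans[OF sum_mono2 sum_mono] sum_mono2) (auto intro!: sum_nonneg)
  also have "\<dots> = real k ^ 3 / (real n)\<^sup>2"
    by (simp add: power3_eq_cube)
  finally show ?thesis .
qed

lemma unif_avg_collide_diff:
  assumes "1 \<le> n" "i < k" "j < k" "i \<noteq> j"
  shows "unif_avg n k (\<lambda>x. real (multi_boxes n k x + 1 - multi_boxes n k (x(j := x i))))
    \<le> (2 * real k - 3) / real n"
proof -
  have "unif_avg n k (\<lambda>x. real (multi_boxes n k x + 1 - multi_boxes n k (x(j := x i))))
      \<le> unif_avg n k (\<lambda>x. (\<Sum>l\<in>{..<k} - {i, j}. of_bool (x l = x i)) + (\<Sum>l\<in>{..<k} - {j}. of_bool (x l = x j)))"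
    using assms by (intro unif_avg_mono multi_boxes_collide)
  also have "\<dots> = (\<Sum>l\<in>{..<k} - {i, j}. unif_avg n k (\<lambda>x. of_bool (x l = x i)))
      + (\<Sum>l\<in>{..<k} - {j}. unif_avg n k (\<lambda>x. of_bool (x l = x j)))"
    by (simp only: unif_avg_add unif_avg_sum)
  also have "\<dots> = (\<Sum>l\<in>{..<k} - {i, j}. 1 / real n) + (\<Sum>l\<in>{..<k} - {j}. 1 / real n)"
    using assms by (intro arg_cong2[where f = "(+)"] sum.cong refl unif_avg_pair) auto
  also have "\<dots> = (real (k - 2) + real (k - 1)) / real n"
    using assms by (simp add: card_Diff_subset add_divide_distrib del: of_nat_diff)
  \<comment> \<open>Distinct \<open>i\<close> and \<open>j\<close> below \<open>k\<close> force
    \<open>2 <= k\<close>, so neither natural subtraction truncates.\<close>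
  also have "real (k - 2) + real (k - 1) = 2 * real k - 3"
    using assms by simp
  finally show ?thesis .
qed

lemma stein_error_bound:
  fixes n k :: nat and \<Phi> \<Delta> l :: real and f :: "nat \<Rightarrow> real"
  assumes n: "1 \<le> n" and k: "1 \<le> k"
    and bound: "\<And>m. \<bar>f m\<bar> \<le> \<Phi>"
    and lip: "\<And>i j. 1 \<le> i \<Longrightarrow> i \<le> j \<Longrightarrow> \<bar>f j - f i\<bar> \<le> \<Delta> * real (j - i)"
    and l: "l = (real k)\<^sup>2 / (2 * real n)"
  shows "\<bar>unif_avg n k (\<lambda>x. l * f (multi_boxes n k x + 1) - real (multi_boxes n k x) * f (multi_boxes n k x))\<bar>
    \<le> \<Phi> * (real k / (2 * real n) + real k ^ 3 / (3 * (real n)\<^sup>2)) + \<Delta> * (real k ^ 3 / (real n)\<^sup>2)"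
proof -
  let ?W = "multi_boxes n k" and ?E = "unif_avg n k"
  have \<Phi>: "0 \<le> \<Phi>" using bound[of 1] by simp
  have \<Delta>: "0 \<le> \<Delta>" using lip[of 1 2] by simp
  \<comment> \<open>\<open>S\<close> is the error of moving a ball, summed over ordered pairs;
    \<open>R\<close> is the error of replacing the box count by half of
    \<open>coll_pairs\<close>.\<close>
  define S where "S = (\<Sum>i<k. \<Sum>j\<in>{..<k} - {i}. ?E (\<lambda>x. f (?W x + 1) - f (?W (x(j := x i)))))"
  define R where "R = ?E (\<lambda>x. (coll_pairs k x / 2 - real (?W x)) * f (?W x))"
  have pairs: "(\<Sum>i<k. \<Sum>j\<in>{..<k} - {i}. c) = real k * (real k - 1) * c" for c :: real
    using k by simp
  have "?E (\<lambda>x. coll_pairs k x * f (?W x)) = (real k * (real k - 1) * ?E (\<lambda>x. f (?W x + 1)) - S) / real n"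
    unfolding unif_avg_coll_pairs_mult[OF n] S_def unif_avg_diff sum_subtractf pairs by simp
  moreover have "?E (\<lambda>x. l * f (?W x + 1) - real (?W x) * f (?W x))
      = l * ?E (\<lambda>x. f (?W x + 1)) - 1/2 * ?E (\<lambda>x. coll_pairs k x * f (?W x)) + R"
    unfolding R_def unif_avg_cmult[symmetric] unif_avg_add[symmetric] unif_avg_diff[symmetric]
    by (intro unif_avg_cong) (simp add: algebra_simps)
  \<comment> \<open>The first coefficient is the deficit of the mean number of pairs:
    \<open>l\<close> minus \<open>k * (k - 1) / (2 * n)\<close>.\<close>
  ultimately have decomp: "?E (\<lambda>x. l * f (?W x + 1) - real (?W x) * f (?W x))
      = real k / (2 * real n) * ?E (\<lambda>x. f (?W x + 1)) + S / (2 * real n) + R"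
    using n by (simp add: l field_simps power2_eq_square)

  have "\<bar>?E (\<lambda>x. f (?W x + 1))\<bar> \<le> ?E (\<lambda>_. \<Phi>)"
    by (intro order.trans[OF unif_avg_abs] unif_avg_mono bound)
  then have "\<bar>?E (\<lambda>x. f (?W x + 1))\<bar> \<le> \<Phi>"
    by (simp add: unif_avg_const[OF n])
  then have 1: "\<bar>real k / (2 * real n) * ?E (\<lambda>x. f (?W x + 1))\<bar> \<le> real k / (2 * real n) * \<Phi>"
    unfolding abs_mult by (intro mult_mono) auto

  have "\<bar>?E (\<lambda>x. f (?W x + 1) - f (?W (x(j := x i))))\<bar> \<le> \<Delta> * ((2 * real k - 3) / real n)"
    if "i \<in> {..<k}" "j \<in> {..<k} - {i}" for i j
  proof -
    have ij: "i < k" "j < k" "i \<noteq> j" using that by auto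
    have "\<bar>?E (\<lambda>x. f (?W x + 1) - f (?W (x(j := x i))))\<bar>
        \<le> ?E (\<lambda>x. \<Delta> * real (?W x + 1 - ?W (x(j := x i))))"
      using ij by (intro order.trans[OF unif_avg_abs] unif_avg_mono lip multi_boxes_collide)
    also have "\<dots> \<le> \<Delta> * ((2 * real k - 3) / real n)"
      unfolding unif_avg_cmult using ij \<Delta> by (intro mult_left_mono unif_avg_collide_diff n)
    finally show ?thesis .
  qed
  then have "\<bar>S\<bar> \<le> (\<Sum>i<k. \<Sum>j\<in>{..<k} - {i}. \<Delta> * ((2 * real k - 3) / real n))"
    unfolding S_def by (intro order.trans[OF sum_abs] sum_mono order.trans[OF sum_abs])
  also have "\<dots> = \<Delta> * (real k * (real k - 1) * (2 * real k - 3)) / real n"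
    by (simp add: pairs)
  also have "\<dots> \<le> \<Delta> * (2 * real k ^ 3) / real n"
  proof (intro divide_right_mono mult_left_mono \<Delta>)
    \<comment> \<open>This product is the difference of the two sides below.\<close>
    have "0 \<le> real k * (5 * real k - 3)" using k by simp
    then show "real k * (real k - 1) * (2 * real k - 3) \<le> 2 * real k ^ 3"
      by (simp add: algebra_simps power3_eq_cube)
  qed simp
  finally have "\<bar>S\<bar> / (2 * real n) \<le> \<Delta> * (2 * real k ^ 3) / real n / (2 * real n)"
    using n by (intro divide_right_mono) auto
  then have 2: "\<bar>S / (2 * real n)\<bar> \<le> \<Delta> * (real k ^ 3 / (real n)\<^sup>2)"
    by (simp add: power2_eq_square)

  have "\<bar>R\<bar> \<le> ?E (\<lambda>x. \<Phi> / 3 * coll_triples k x)"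
    unfolding R_def
  proof (intro order.trans[OF unif_avg_abs] unif_avg_mono)
    fix x assume x: "x \<in> {..<k} \<rightarrow>\<^sub>E {..<n}"
    have "\<bar>(coll_pairs k x / 2 - real (?W x)) * f (?W x)\<bar> \<le> (coll_pairs k x / 2 - real (?W x)) * \<Phi>"
      using pairs_minus_boxes(1)[OF x] bound[of "?W x"] by (simp add: abs_mult mult_left_mono)
    also have "\<dots> \<le> coll_triples k x / 3 * \<Phi>"
      using pairs_minus_boxes(2)[OF x] \<Phi> by (intro mult_right_mono)
    finally show "\<bar>(coll_pairs k x / 2 - real (?W x)) * f (?W x)\<bar> \<le> \<Phi> / 3 * coll_triples k x"
      by (simp add: mult_ac)
  qed
  also have "\<dots> \<le> \<Phi> / 3 * (real k ^ 3 / (real n)\<^sup>2)"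
    unfolding unif_avg_cmult using \<Phi> by (intro mult_left_mono unif_avg_coll_triples n) auto
  finally have 3: "\<bar>R\<bar> \<le> \<Phi> / 3 * (real k ^ 3 / (real n)\<^sup>2)" .

  have "\<bar>real k / (2 * real n) * ?E (\<lambda>x. f (?W x + 1)) + S / (2 * real n) + R\<bar>
     \<le> real k / (2 * real n) * \<Phi> + \<Delta> * (real k ^ 3 / (real n)\<^sup>2) + \<Phi> / 3 * (real k ^ 3 / (real n)\<^sup>2)"
    using 1 2 3 by linarith
  then show ?thesis unfolding decomp by (simp add: algebra_simps)
qed

text \<open>In the application \<open>q\<close> is k/n and \<open>2 * l * q\<close> is k^3/n^2. For
  \<open>l < 1\<close> both minima are 1 and 8/3 <= 19/6 decides. For \<open>l >= 1\<close>,
  factoring out \<open>q / s\<close> with \<open>s = sqrt l\<close> leaves an inequality in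
  \<open>s\<close> and \<open>\<Phi> * s\<close>.\<close>

lemma stein_error_numeric:
  fixes l q \<Phi> :: real
  assumes "0 < l" "0 \<le> q" and \<Phi>: "\<Phi> \<le> 1" "1 \<le> l \<Longrightarrow> \<Phi> \<le> 3 / sqrt l"
  shows "\<Phi> * (q / 2 + 2 * l * q / 3) + min 1 (1 / l) * (2 * l * q)
    \<le> min 1 (1 / sqrt l) * (q / 2 + 19 / 6 * l * q)"
proof (cases "1 \<le> l")
  case False
  then have "1 / l \<ge> 1" "1 / sqrt l \<ge> 1" using assms(1) by auto
  moreover have "\<Phi> * (q / 2 + 2 * l * q / 3) \<le> 1 * (q / 2 + 2 * l * q / 3)"
    using assms by (intro mult_right_mono) auto
  moreover have "0 \<le> l * q" using assms by simp
  ultimately show ?thesis by (simp add: min_absorb1)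
next
  case True
  define s where "s = sqrt l"
  have s: "1 \<le> s" "l = s * s" using True assms(1) by (auto simp: s_def)
  have min: "min 1 (1 / l) = 1 / l" "min 1 (1 / sqrt l) = 1 / s"
    using True s(1) by (auto simp: s_def[symmetric] min_def)
  have "\<Phi> * s * (1/2 + 2/3 * s\<^sup>2) + 2 * s \<le> 1/2 + 19/6 * s\<^sup>2"
  \<comment> \<open>The bounds \<open>\<Phi> <= 1\<close> and \<open>\<Phi> * s <= 3\<close>
    coincide at \<open>s = 3\<close>; each is used where it is the better one.\<close>
  proof (cases "s \<le> 3")
    case le: True
    have "\<Phi> * s * (1/2 + 2/3 * s\<^sup>2) \<le> 1 * s * (1/2 + 2/3 * s\<^sup>2)"
      using s \<Phi>(1) by (intro mult_right_mono) auto
    \<comment> \<open>With \<open>\<Phi>\<close> replaced by 1, six times the slack is this product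
      plus 3.\<close>
    moreover have "s * ((15 - 4 * s) * (s - 1)) \<ge> 0"
      using s le by (intro mult_nonneg_nonneg) auto
    ultimately show ?thesis
      by (simp add: algebra_simps power2_eq_square)
  next
    case False
    have le: "3 * s \<le> s\<^sup>2"
      unfolding power2_eq_square using False by (intro mult_right_mono) auto
    have "\<Phi> * s \<le> 3"
      using \<Phi>(2)[OF True] s(1) by (simp add: s_def[symmetric] pos_le_divide_eq)
    then have "\<Phi> * s * (1/2 + 2/3 * s\<^sup>2) + 2 * s \<le> 3 * (1/2 + 2/3 * s\<^sup>2) + 2 * s"
      by (intro add_right_mono mult_right_mono) auto
    also have "3 * (1/2 + 2/3 * s\<^sup>2) + 2 * s \<le> 1/2 + 19/6 * s\<^sup>2"
      using False le by (simp add: distrib_left)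
    finally show ?thesis .
  qed
  then have "q / s * (\<Phi> * s * (1/2 + 2/3 * s\<^sup>2) + 2 * s) \<le> q / s * (1/2 + 19/6 * s\<^sup>2)"
    using s assms(2) by (intro mult_left_mono) auto
  moreover have "\<Phi> * (q / 2 + 2 * l * q / 3) + 1 / l * (2 * l * q)
      = q / s * (\<Phi> * s * (1/2 + 2/3 * s\<^sup>2) + 2 * s)"
    using s by (simp add: field_simps power2_eq_square)
  moreover have "1 / s * (q / 2 + 19 / 6 * l * q) = q / s * (1/2 + 19/6 * s\<^sup>2)"
    using s by (simp add: field_simps power2_eq_square)
  ultimately show ?thesis
    by (simp only: min)
qed

section \<open>The law of the box count as an average over placements\<close>

lemma multi_boxes_cong:
  "(\<And>i. i < k \<Longrightarrow> x i = y i) \<Longrightarrow> multi_boxes n k x = multi_boxes n k y"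
  unfolding multi_boxes_def by (intro arg_cong[where f = card] Collect_cong conj_cong refl arg_cong2[where f = "(\<le>)"]) auto

lemma measurable_multi_boxes:
  assumes X: "\<And>i. i < k \<Longrightarrow> X i \<in> measurable M (count_space UNIV)"
  shows "(\<lambda>\<omega>. multi_boxes n k (\<lambda>i. X i \<omega>)) \<in> measurable M (count_space UNIV)"
proof -
  have card: "(\<lambda>\<omega>. card {i\<in>{..<k}. X i \<omega> = b}) \<in> measurable M (count_space UNIV)" for b
  proof (rule measurable_card)
    fix i
    show "{\<omega>\<in>space M. i \<in> {i\<in>{..<k}. X i \<omega> = b}} \<in> sets M"
    proof (cases "i < k")
      case True
      have "{\<omega>\<in>space M. i \<in> {i\<in>{..<k}. X i \<omega> = b}} = X i -` {b} \<inter> space M"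
        using True by auto
      then show ?thesis using measurable_sets[OF X[OF True], of "{b}"] by simp
    qed simp
  qed
  show ?thesis
    unfolding multi_boxes_def
  proof (rule measurable_card)
    fix b
    show "{\<omega>\<in>space M. b \<in> {b\<in>{..<n}. 2 \<le> card {i\<in>{..<k}. X i \<omega> = b}}} \<in> sets M"
    proof (cases "b < n")
      case True
      have eq: "{\<omega>\<in>space M. b \<in> {b\<in>{..<n}. 2 \<le> card {i\<in>{..<k}. X i \<omega> = b}}}
          = (\<lambda>\<omega>. card {i\<in>{..<k}. X i \<omega> = b}) -` {2..} \<inter> space M"
        using True by auto
      show ?thesis unfolding eq by (rule measurable_sets[OF card]) simp
    qed simp
  qed
qed

lemma multi_boxes_law:
  fixes M :: "'a measure" and X :: "nat \<Rightarrow> 'a \<Rightarrow> nat"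
  assumes "1 \<le> n" and "1 \<le> k" and "prob_space M"
    and indep: "prob_space.indep_vars M (\<lambda>_. count_space UNIV) X {..<k}"
    and unif: "\<And>i. i < k \<Longrightarrow> distr M (count_space UNIV) (X i) = measure_pmf (pmf_of_set {..<n})"
  shows "measure (distr M (count_space UNIV) (\<lambda>\<omega>. multi_boxes n k (\<lambda>i. X i \<omega>))) A
    = unif_avg n k (\<lambda>x. indicator A (multi_boxes n k x))"
proof -
  interpret prob_space M by fact
  define W where "W \<omega> = multi_boxes n k (\<lambda>i. X i \<omega>)" for \<omega>
  let ?P = "{..<k} \<rightarrow>\<^sub>E {..<n}"
  \<comment> \<open>\<open>E x\<close> is the event that the placement is \<open>x\<close>. By
    \<open>1 <= k\<close> the index set is nonempty; an empty intersection would be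
    \<open>UNIV\<close> instead of \<open>space M\<close>.\<close>
  define E where "E x = (\<Inter>i\<in>{..<k}. X i -` {x i} \<inter> space M)" for x
  have k0: "{..<k} \<noteq> {}" using assms(2) by (auto simp: lessThan_empty_iff)
  have fin: "finite ?P" by (intro finite_PiE) auto
  have X: "X i \<in> measurable M (count_space UNIV)" if "i < k" for i
    using indep that by (auto simp: indep_vars_def2)
  have W: "W \<in> measurable M (count_space UNIV)"
    unfolding W_def[abs_def] by (intro measurable_multi_boxes X)
  have E_sets: "E x \<in> sets M" for x
    unfolding E_def using k0 X by (intro sets.finite_INT) (auto intro!: measurable_sets)
  have E_prob: "prob (E x) = 1 / real n ^ k" if x: "x \<in> ?P" for x
  proof -
    have "prob (E x) = (\<Prod>i<k. prob (X i -` {x i} \<inter> space M))"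
      unfolding E_def by (rule indep_varsD_finite[OF indep k0]) auto
    also have "\<dots> = (\<Prod>i<k. 1 / real n)"
    proof (intro prod.cong refl)
      fix i assume i: "i \<in> {..<k}"
      have "prob (X i -` {x i} \<inter> space M) = measure (distr M (count_space UNIV) (X i)) {x i}"
        using X i by (simp add: measure_distr)
      also have "\<dots> = pmf (pmf_of_set {..<n}) (x i)"
        using unif i by (simp add: measure_pmf_single)
      also have "\<dots> = 1 / real n"
      proof -
        have "x i \<in> {..<n}" using x i by (rule PiE_mem)
        moreover have "{..<n} \<noteq> {}" using assms(1) by (auto simp: lessThan_empty_iff)
        ultimately show ?thesis by simp
      qed
      finally show "prob (X i -` {x i} \<inter> space M) = 1 / real n" .
    qed
    finally show ?thesis by (simp add: power_one_over)
  qed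
  have disj: "disjoint_family_on E ?P"
    unfolding disjoint_family_on_def
  proof (intro ballI impI)
    fix x y assume xy: "x \<in> ?P" "y \<in> ?P" "x \<noteq> y"
    then obtain i where "i < k" "x i \<noteq> y i" using PiE_ext[OF xy(1,2)] by auto
    then show "E x \<inter> E y = {}" by (auto simp: E_def)
  qed
  \<comment> \<open>The \<open>X i\<close> lie in \<open>{..<n}\<close> only almost surely, so the
    events \<open>E x\<close> cover a set of full probability, possibly not all of
    \<open>space M\<close>.\<close>
  have total: "prob (\<Union>x\<in>?P. E x) = 1"
    using finite_measure_finite_Union[OF fin _ disj] E_sets assms(1)
    by (auto simp: E_prob card_PiE)
  have event: "W -` A \<inter> space M \<inter> E x = (if multi_boxes n k x \<in> A then E x else {})" for x
  proof -
    have "W \<omega> = multi_boxes n k x" if "\<omega> \<in> E x" for \<omega>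
    proof -
      have "X i \<omega> = x i" if "i < k" for i
        using \<open>\<omega> \<in> E x\<close> that unfolding E_def by blast
      then show ?thesis unfolding W_def by (rule multi_boxes_cong)
    qed
    moreover have "E x \<subseteq> space M" using E_sets by (rule sets.sets_into_space)
    ultimately show ?thesis by auto
  qed
  have "measure (distr M (count_space UNIV) W) A = prob (W -` A \<inter> space M)"
    using W by (simp add: measure_distr)
  also have "\<dots> = prob (W -` A \<inter> space M \<inter> (\<Union>x\<in>?P. E x))"
    using total W E_sets fin
    by (intro measure_space_inter[symmetric]) (auto simp: prob_space intro!: measurable_sets)
  also have "\<dots> = prob (\<Union>x\<in>?P. W -` A \<inter> space M \<inter> E x)"
    by (simp only: Int_UN_distrib)
  also have "\<dots> = (\<Sum>x\<in>?P. prob (W -` A \<inter> space M \<inter> E x))"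
    using fin disj E_sets W
    by (intro finite_measure_finite_Union) (auto simp: disjoint_family_on_def intro!: measurable_sets)
  also have "\<dots> = (\<Sum>x\<in>?P. indicator A (multi_boxes n k x) / real n ^ k)"
    by (intro sum.cong refl) (simp add: event E_prob)
  finally show ?thesis
    unfolding W_def[abs_def] by (simp add: unif_avg_def sum_divide_distrib)
qed

theorem theorem7:
  fixes n k :: nat and \<theta> :: real
    and M :: "'a measure" and X :: "nat \<Rightarrow> 'a \<Rightarrow> nat" and W :: "'a \<Rightarrow> nat"
  assumes "n \<ge> 1" and "k \<ge> 1"
    and "\<theta> > 0" and "real k = \<theta> * sqrt (real n)"
    and "prob_space M"
    and "prob_space.indep_vars M (\<lambda>_. count_space UNIV) X {..<k}"
    and "\<And>i. i < k \<Longrightarrow>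
           distr M (count_space UNIV) (X i) = measure_pmf (pmf_of_set {..<n})"
    and "W = (\<lambda>\<omega>. multi_boxes n k (\<lambda>i. X i \<omega>))"
  shows "tv_dist (distr M (count_space UNIV) W) (measure_pmf (poisson_pmf (\<theta>\<^sup>2 / 2)))
           \<le> min 1 (sqrt 2 / \<theta>) *
             ((19 * \<theta> ^ 3 + 6 * \<theta>) / (12 * sqrt (real n)) + \<theta>\<^sup>2 / (2 * real n))"
proof -
  define l where "l = \<theta>\<^sup>2 / 2"
  define q where "q = real k / real n"
  \<comment> \<open>One number for both bounds on the Stein solution, since
    \<open>stein_error_numeric\<close> draws on each of them.\<close>
  define \<Phi> where "\<Phi> = (if 1 \<le> l then min 1 (3 / sqrt l) else 1)"
  have l: "0 < l" using assms(3) by (simp add: l_def)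
  have q: "0 \<le> q" by (simp add: q_def)
  have sq: "sqrt (real n) * sqrt (real n) = real n" "0 < sqrt (real n)" using assms(1) by auto
  have "(real k)\<^sup>2 = \<theta>\<^sup>2 * real n"
    using sq by (simp add: assms(4) power_mult_distrib)
  then have l_eq: "l = (real k)\<^sup>2 / (2 * real n)"
    using assms(1) by (simp add: l_def field_simps)
  have q_eq: "q = \<theta> / sqrt (real n)"
    using sq by (simp add: q_def assms(4) field_simps)
  have cube: "real k ^ 3 / (real n)\<^sup>2 = 2 * l * q"
    using assms(1) by (simp add: l_eq q_def field_simps power2_eq_square power3_eq_cube)
  have sol: "\<bar>stein_sol l A m\<bar> \<le> \<Phi>" for A m
    using l stein_sol_bound_1[OF l] stein_sol_bound_sqrt by (cases m) (auto simp: \<Phi>_def)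
  have main: "\<bar>measure (distr M (count_space UNIV) W) A - measure (measure_pmf (poisson_pmf l)) A\<bar>
      \<le> min 1 (1 / sqrt l) * (q / 2 + 19 / 6 * l * q)" for A
  proof -
    have "measure (distr M (count_space UNIV) W) A - measure (measure_pmf (poisson_pmf l)) A
        = unif_avg n k (\<lambda>x. indicator A (multi_boxes n k x) - poi_prob l A)"
      using multi_boxes_law[OF assms(1,2,5,6,7), of A] assms(1,8)
      by (simp add: unif_avg_diff unif_avg_const poi_prob_def)
    also have "\<dots> = unif_avg n k (\<lambda>x. l * stein_sol l A (multi_boxes n k x + 1)
        - real (multi_boxes n k x) * stein_sol l A (multi_boxes n k x))"
      by (intro unif_avg_cong) (simp only: Suc_eq_plus1[symmetric] stein_sol_eq[OF l])
    also have "\<bar>\<dots>\<bar> \<le> \<Phi> * (real k / (2 * real n) + real k ^ 3 / (3 * (real n)\<^sup>2))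
        + min 1 (1 / l) * (real k ^ 3 / (real n)\<^sup>2)"
      by (rule stein_error_bound[OF assms(1,2) sol stein_sol_lipschitz[OF l] l_eq])
    also have "\<dots> = \<Phi> * (q / 2 + 2 * l * q / 3) + min 1 (1 / l) * (2 * l * q)"
      unfolding cube[symmetric] by (simp add: q_def)
    also have "\<dots> \<le> min 1 (1 / sqrt l) * (q / 2 + 19 / 6 * l * q)"
      using l q by (intro stein_error_numeric) (auto simp: \<Phi>_def)
    finally show ?thesis .
  qed
  have "tv_dist (distr M (count_space UNIV) W) (measure_pmf (poisson_pmf l))
      \<le> min 1 (1 / sqrt l) * (q / 2 + 19 / 6 * l * q)"
    unfolding tv_dist_def by (intro cSUP_least main) auto
  also have "\<dots> \<le> min 1 (1 / sqrt l) * ((19 * \<theta> ^ 3 + 6 * \<theta>) / (12 * sqrt (real n)) + \<theta>\<^sup>2 / (2 * real n))"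
  proof (intro mult_left_mono)
    \<comment> \<open>With \<open>q = \<theta> / sqrt n\<close> and
      \<open>l = \<theta>^2 / 2\<close>, the summand \<open>q / 2\<close> is the linear term of the
      fraction and \<open>19 / 6 * l * q\<close> the cubic one.\<close>
    have "q / 2 + 19 / 6 * l * q = (19 * \<theta> ^ 3 + 6 * \<theta>) / (12 * sqrt (real n))"
      using sq by (simp add: q_eq l_def field_simps power2_eq_square power3_eq_cube)
    then show "q / 2 + 19 / 6 * l * q \<le> (19 * \<theta> ^ 3 + 6 * \<theta>) / (12 * sqrt (real n)) + \<theta>\<^sup>2 / (2 * real n)"
      by simp
  qed (use l in auto)
  also have "1 / sqrt l = sqrt 2 / \<theta>"
    using assms(3) by (simp add: l_def real_sqrt_divide)
  finally show ?thesis by (simp add: l_def)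
qed

end
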